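(* If $r$ is a BURD rotor type, then $UD(r)\equiv DU(r)\equiv r$.
   Context: A two-state rotor type is an infinite periodic sequence $r=(r^{(1)},r^{(2)},\dots)$ over $\{1,2\}$ with fundamental period $|r|$ (convention $r^{(1)}=1$); $r\equiv r'$ means one is obtained from the other by an injective relabeling of states. $r$ is balanced if $1$ and $2$ occur equally often in a period. A run is a contiguous block of consecutive positions; it is balanced if it contains equally many $1$'s and $2$'s, uniform if all its terms are equal. A balanced run decomposition (BRD) of a balanced $r$ is a partition of the period of $r$ into contiguous balanced runs; its type is the infinite periodic sequence $(b_1,b_2,\dots)$ where $2b_i$ is the length of the $i$-th run, $i$ taken modulo the number of runs. A uniform run decomposition (URD) of $r$ is a partition of the period of $r$ into contiguous uniform runs; its type is the infinite periodic sequence $(u_1,u_2,\dots)$ where $u_i$ is the length of the $i$-th run, $i$ taken modulo the number of runs. A BURD rotor type is a balanced rotor type that has a BRD and a URD of the same type. Rotor-router dynamics: at each non-target vertex $v$ there is a periodic sequence $e_v^{(1)},e_v^{(2)},\dots$ of out-edges; a particle starts at the source, on its $j$-th visit to $v$ leaves along $e_v^{(j)}$, and whenever it reaches a target it is returned to the source; the hitting sequence is the sequence of targets reached. The compressor for $r$ has non-target vertices $1$ (source), $2,3$ and targets $4,5$. On the $j$-th departure: from vertex $1$ the particle goes to vertex $2$ if $r^{(j)}=1$ and to vertex $3$ if $r^{(j)}=2$; from vertex $2$, in variant $U$ it goes to vertex $1$ if $r^{(j)}=1$ and to target $4$ if $r^{(j)}=2$, in variant $D$ to target $4$ if $r^{(j)}=1$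 and to vertex $1$ if $r^{(j)}=2$; from vertex $3$ likewise with target $5$. $UD(r)$ (resp. $DU(r)$) is the hitting sequence with variant $U$ at vertex $2$ and $D$ at $3$ (resp. $D$ at $2$, $U$ at $3$), viewed as a rotor type. *)

theory Defs
  imports Main "HOL-Library.Infinite_Set"
begin

text \<open>Sequences are functions on \<open>nat\<close> indexed from \<open>0\<close>: the informal \<open>r\<^sup>(\<^sup>j\<^sup>)\<close> with \<open>j \<ge> 1\<close>
  is \<open>r (j - 1)\<close>, and likewise for decomposition types and for departures from a vertex.\<close>

definition is_period :: "(nat \<Rightarrow> 'a) \<Rightarrow> nat \<Rightarrow> bool" where
  "is_period r p \<longleftrightarrow> p > 0 \<and> (\<forall>n. r (n + p) = r n)"

definition fundamental_period :: "(nat \<Rightarrow> 'a) \<Rightarrow> nat" where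
  "fundamental_period r = (LEAST p. is_period r p)"

definition two_state_rotor_type :: "(nat \<Rightarrow> nat) \<Rightarrow> bool" where
  "two_state_rotor_type r \<longleftrightarrow> (\<exists>p. is_period r p) \<and> range r \<subseteq> {1, 2} \<and> r 0 = 1"

definition relabel_equiv :: "(nat \<Rightarrow> 'a) \<Rightarrow> (nat \<Rightarrow> 'b) \<Rightarrow> bool" where
  "relabel_equiv r r' \<longleftrightarrow> (\<exists>f. inj_on f (range r) \<and> r' = f \<circ> r)"

definition period_word :: "(nat \<Rightarrow> 'a) \<Rightarrow> 'a list" where
  "period_word r = map r [0..<fundamental_period r]"

definition balanced_run :: "nat list \<Rightarrow> bool" where
  "balanced_run w \<longleftrightarrow> count_list w 1 = count_list w 2"

definition uniform_run :: "nat list \<Rightarrow> bool" where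
  "uniform_run w \<longleftrightarrow> (\<forall>x\<in>set w. \<forall>y\<in>set w. x = y)"

definition balanced :: "(nat \<Rightarrow> nat) \<Rightarrow> bool" where
  "balanced r \<longleftrightarrow> balanced_run (period_word r)"

text \<open>A partition of the period into contiguous runs is the list of its (nonempty) blocks in order,
  starting at the first term of \<open>r\<close>; runs do not wrap around the end of the period. Uniform runs
  need not be maximal, and neighbouring ones may have the same state.\<close>

definition run_decomposition :: "(nat \<Rightarrow> 'a) \<Rightarrow> 'a list list \<Rightarrow> bool" where
  "run_decomposition r ws \<longleftrightarrow> concat ws = period_word r \<and> (\<forall>w\<in>set ws. w \<noteq> [])"

definition is_BRD :: "(nat \<Rightarrow> nat) \<Rightarrow> nat list list \<Rightarrow> bool" where
  "is_BRD r ws \<longleftrightarrow> run_decomposition r ws \<and> (\<forall>w\<in>set ws. balanced_run w)"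

definition is_URD :: "(nat \<Rightarrow> nat) \<Rightarrow> nat list list \<Rightarrow> bool" where
  "is_URD r ws \<longleftrightarrow> run_decomposition r ws \<and> (\<forall>w\<in>set ws. uniform_run w)"

text \<open>Over the states 1 and 2 a balanced run has even length, so the division is exact.\<close>

definition BRD_type :: "nat list list \<Rightarrow> nat \<Rightarrow> nat" where
  "BRD_type ws i = length (ws ! (i mod length ws)) div 2"

definition URD_type :: "nat list list \<Rightarrow> nat \<Rightarrow> nat" where
  "URD_type ws i = length (ws ! (i mod length ws))"

definition BURD_rotor_type :: "(nat \<Rightarrow> nat) \<Rightarrow> bool" where
  "BURD_rotor_type r \<longleftrightarrow> two_state_rotor_type r \<and> balanced r \<and>
     (\<exists>bs us. is_BRD r bs \<and> is_URD r us \<and> BRD_type bs = URD_type us)"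

text \<open>A rotor configuration is given by the head \<open>e v j\<close> of the out-edge used on departure number
  \<open>j\<close> from the non-target \<open>v\<close> (values at targets are never used), a source \<open>s\<close> and a set \<open>T\<close> of
  targets. A state of the walk is the particle's vertex together with the number of departures
  made so far from each vertex.\<close>

definition rotor_step ::
    "('v \<Rightarrow> nat \<Rightarrow> 'v) \<Rightarrow> 'v \<Rightarrow> 'v set \<Rightarrow> 'v \<times> ('v \<Rightarrow> nat) \<Rightarrow> 'v \<times> ('v \<Rightarrow> nat)" where
  "rotor_step e s T = (\<lambda>(v, c). if v \<in> T then (s, c) else (e v (c v), c(v := Suc (c v))))"

definition rotor_walk :: "('v \<Rightarrow> nat \<Rightarrow> 'v) \<Rightarrow> 'v \<Rightarrow> 'v set \<Rightarrow> nat \<Rightarrow> 'v" where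
  "rotor_walk e s T t = fst ((rotor_step e s T ^^ t) (s, \<lambda>_. 0))"

text \<open>Meaningful when targets are reached infinitely often, as is the case for the compressors
  below when \<open>r\<close> is a two-state rotor type in which both states occur (e.g. a balanced one).\<close>

definition hitting_sequence :: "('v \<Rightarrow> nat \<Rightarrow> 'v) \<Rightarrow> 'v \<Rightarrow> 'v set \<Rightarrow> nat \<Rightarrow> 'v" where
  "hitting_sequence e s T n = rotor_walk e s T (enumerate {t. rotor_walk e s T t \<in> T} n)"

datatype variant = VariantU | VariantD

fun compressor_exit :: "variant \<Rightarrow> nat \<Rightarrow> nat \<Rightarrow> nat" where
  "compressor_exit VariantU target x = (if x = 1 then 1 else target)"
| "compressor_exit VariantD target x = (if x = 1 then target else 1)"

definition compressor :: "(nat \<Rightarrow> nat) \<Rightarrow> variant \<Rightarrow> variant \<Rightarrow> nat \<Rightarrow> nat \<Rightarrow> nat" where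
  "compressor r X Y v j =
     (if v = 1 then (if r j = 1 then 2 else 3)
      else if v = 2 then compressor_exit X 4 (r j)
      else compressor_exit Y 5 (r j))"

definition UD :: "(nat \<Rightarrow> nat) \<Rightarrow> nat \<Rightarrow> nat" where
  "UD r = hitting_sequence (compressor r VariantU VariantD) 1 {4, 5}"

definition DU :: "(nat \<Rightarrow> nat) \<Rightarrow> nat \<Rightarrow> nat" where
  "DU r = hitting_sequence (compressor r VariantD VariantU) 1 {4, 5}"

end

theory Submission
  imports Defs
begin

text \<open>Let \<open>u\<close> be the common type of the two decompositions and \<open>S\<close> its partial sums. While vertex 1
  works through the \<open>i\<close>-th balanced run, each of the vertices 2 and 3 is visited exactly
  \<open>u\<^sub>i\<close> times, hence works through the \<open>i\<close>-th uniform run. On that run one of these two vertices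
  always sends the particle back and the other always sends it to its target, so that \<open>u\<^sub>i\<close> equal
  targets are hit, and which one is determined by the state of the \<open>i\<close>-th uniform run.\<close>

section \<open>Prefix counts and enumeration\<close>

definition count_below :: "(nat \<Rightarrow> bool) \<Rightarrow> nat \<Rightarrow> nat" where
  "count_below P n = card {j. j < n \<and> P j}"

lemma count_below_0 [simp]: "count_below P 0 = 0"
  by (simp add: count_below_def)

lemma count_below_Suc [simp]: "count_below P (Suc n) = count_below P n + (if P n then 1 else 0)"
proof -
  have "{j. j < Suc n \<and> P j} = (if P n then insert n {j. j < n \<and> P j} else {j. j < n \<and> P j})"
    by (auto simp: less_Suc_eq)
  then show ?thesis by (simp add: count_below_def)
qed

lemma count_below_mono: "m \<le> n \<Longrightarrow> count_below P m \<le> count_below P n"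
  by (auto simp: count_below_def intro!: card_mono)

lemma count_below_add_count_list:
  "a \<le> b \<Longrightarrow> count_below (\<lambda>j. f j = x) b
     = count_below (\<lambda>j. f j = x) a + count_list (map f [a..<b]) x"
  by (induction b rule: dec_induct) auto

text \<open>The elements below the \<open>n\<close>-th one are exactly those enumerated before it.
  This turns a description of a hit by the number of earlier hits into one of the hitting
  sequence.\<close>

lemma count_below_enumerate:
  assumes "infinite {t. P t}"
  shows "count_below P (enumerate {t. P t} n) = n"
proof -
  let ?e = "enumerate {t. P t}"
  have "{j. j < ?e n \<and> P j} = ?e ` {..<n}"
  proof (intro equalityI subsetI)
    fix j assume j: "j \<in> {j. j < ?e n \<and> P j}"
    then obtain m where "?e m = j"
      using enumerate_Ex[of "{t. P t}" j] assms by auto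
    with j show "j \<in> ?e ` {..<n}"
      using enumerate_mono_iff[OF assms] by auto
  next
    fix j assume "j \<in> ?e ` {..<n}"
    then show "j \<in> {j. j < ?e n \<and> P j}"
      using enumerate_mono[OF _ assms] enumerate_in_set[OF assms] by auto
  qed
  moreover have "inj_on ?e {..<n}"
    using strict_mono_enumerate[OF assms] by (simp add: strict_mono_imp_inj_on inj_on_subset)
  ultimately show ?thesis
    by (simp add: count_below_def card_image)
qed

section \<open>Blocks of a decomposition as index intervals\<close>

lemma map_upt_add: "map f [a + k..<b + k] = map (\<lambda>j. f (j + k)) [a..<b]" for k :: nat
  by (rule nth_equalityI) (auto simp: ac_simps)

text \<open>Induction strips the first block, which leaves a shifted sequence on a shorter interval;
  hence \<open>f\<close> and \<open>p\<close> vary.\<close>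

lemma concat_eq_map_upt_nth:
  assumes "concat ws = map f [0..<p]" "k < length ws"
  shows "ws ! k = map f [(\<Sum>j<k. length (ws ! j))..<(\<Sum>j<Suc k. length (ws ! j))]"
  using assms
proof (induction ws arbitrary: f p k)
  case (Cons w ws)
  have le: "length w \<le> p" using arg_cong[OF Cons.prems(1), of length] by simp
  have w: "w = map f [0..<length w]"
    using arg_cong[OF Cons.prems(1), of "take (length w)"] le by (simp add: take_map)
  have ws: "concat ws = map (\<lambda>j. f (j + length w)) [0..<p - length w]"
  proof -
    have "concat ws = map f [length w..<p]"
      using arg_cong[OF Cons.prems(1), of "drop (length w)"] by (simp add: drop_map)
    also have "\<dots> = map (\<lambda>j. f (j + length w)) [0..<p - length w]"
      using map_upt_add[of f 0 "length w" "p - length w"] le by simp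
    finally show ?thesis .
  qed
  show ?case
  proof (cases k)
    case 0
    then show ?thesis using w by simp
  next
    case (Suc m)
    let ?s = "\<lambda>k. \<Sum>j<k. length (ws ! j)"
    have eq: "(\<Sum>j<Suc k. length ((w # ws) ! j)) = ?s k + length w" for k
      by (subst sum.lessThan_Suc_shift) simp
    have "(w # ws) ! k = map (\<lambda>j. f (j + length w)) [?s m..<?s (Suc m)]"
      using Cons.IH[OF ws, of m] Cons.prems(2) Suc by simp
    also have "\<dots> = map f [?s m + length w..<?s (Suc m) + length w]"
      by (rule map_upt_add[symmetric])
    finally show ?thesis unfolding Suc eq .
  qed
qed simp

lemma is_period_fundamental_period:
  "is_period r p \<Longrightarrow> is_period r (fundamental_period r)"
  unfolding fundamental_period_def by (rule LeastI)

lemma run_decomposition_not_Nil: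
  assumes "is_period r p" "run_decomposition r ws"
  shows "ws \<noteq> []"
proof
  assume "ws = []"
  then show False
    using assms is_period_fundamental_period[OF assms(1)]
    by (auto simp: run_decomposition_def period_word_def is_period_def)
qed

text \<open>Repeating the blocks cyclically tiles the whole sequence: one cycle of blocks has the
  length of the fundamental period, so moving by a cycle does not change the terms of
  \<open>r\<close>.\<close>

lemma run_decomposition_nth_mod:
  assumes "is_period r p" "run_decomposition r ws"
  defines "l \<equiv> \<lambda>i. length (ws ! (i mod length ws))"
  shows "ws ! (i mod length ws) = map r [(\<Sum>j<i. l j)..<(\<Sum>j<Suc i. l j)]"
proof -
  define q where "q = fundamental_period r"
  define T where "T i = (\<Sum>j<i. l j)" for i
  let ?L = "length ws"
  have per: "r (n + q) = r n" for n
    using is_period_fundamental_period[OF assms(1)] by (simp add: is_period_def q_def)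
  have ws: "concat ws = map r [0..<q]"
    using assms(2) by (simp add: run_decomposition_def period_word_def q_def)
  have T_small: "T k = (\<Sum>j<k. length (ws ! j))" if "k \<le> ?L" for k
    unfolding T_def l_def using that by (intro sum.cong) auto
  have "length (concat ws) = T ?L"
    by (simp add: T_small length_concat sum_list_sum_nth atLeast0LessThan)
  then have TL: "T ?L = q" using ws by simp
  have T_add: "T (i + ?L) = T i + q" for i
  proof (induction i)
    case 0
    then show ?case using TL by (simp add: T_def)
  next
    case (Suc i)
    then show ?case by (simp add: T_def l_def)
  qed
  have "ws ! (i mod ?L) = map r [T i..<T (Suc i)]"
  proof (induction i rule: less_induct)
    case (less i)
    show ?case
    proof (cases "i < ?L")
      case True
      then show ?thesis
        using concat_eq_map_upt_nth[OF ws True] T_small[of i] T_small[of "Suc i"] by simp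
    next
      case False
      define k where "k = i - ?L"
      have i: "i = k + ?L" using False by (simp add: k_def)
      have "ws \<noteq> []" by (rule run_decomposition_not_Nil[OF assms(1,2)])
      then have "k < i" using i by simp
      then have "ws ! (k mod ?L) = map r [T k..<T (Suc k)]" by (rule less)
      moreover have "map r [T i..<T (Suc i)] = map r [T k..<T (Suc k)]"
        unfolding i add_Suc[symmetric] T_add map_upt_add per ..
      ultimately show ?thesis by (simp add: i)
    qed
  qed
  then show ?thesis by (simp only: T_def)
qed

section \<open>Common partial sums of the two decompositions\<close>

locale burd =
  fixes r S :: "nat \<Rightarrow> nat"
  assumes states: "\<And>n. r n \<in> {1, 2}"
    and S_0: "S 0 = 0"
    and S_less_Suc: "\<And>i. S i < S (Suc i)"
    and uniform: "\<And>i n. S i \<le> n \<Longrightarrow> n < S (Suc i) \<Longrightarrow> r n = r (S i)"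
    and balanced: "\<And>i x. x \<in> {1, 2} \<Longrightarrow> count_below (\<lambda>j. r j = x) (2 * S i) = S i"

text \<open>Uniform runs end at the partial sums \<open>S i\<close> of the common type, balanced
  runs at \<open>2 * S i\<close>. Up to the end of a balanced run both states are equally frequent,
  so each occurs \<open>S i\<close> times.\<close>

lemma BURD_rotor_type_burd:
  assumes "BURD_rotor_type r"
  shows "\<exists>S. burd r S"
proof -
  obtain bs us p where p: "is_period r p" and rng: "range r \<subseteq> {1, 2}"
    and bs: "run_decomposition r bs" "\<And>w. w \<in> set bs \<Longrightarrow> balanced_run w"
    and us: "run_decomposition r us" "\<And>w. w \<in> set us \<Longrightarrow> uniform_run w"
    and eq: "BRD_type bs = URD_type us"
    using assms by (auto simp: BURD_rotor_type_def two_state_rotor_type_def is_BRD_def is_URD_def)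
  define S where "S i = (\<Sum>j<i. URD_type us j)" for i
  let ?c = "\<lambda>x. count_below (\<lambda>j. r j = x)"
  have r12: "r n = 1 \<or> r n = 2" for n using rng by auto
  have bs_in: "bs ! (i mod length bs) \<in> set bs" for i
    using run_decomposition_not_Nil[OF p bs(1)] by simp
  have us_in: "us ! (i mod length us) \<in> set us" for i
    using run_decomposition_not_Nil[OF p us(1)] by simp
  have c_add: "?c 1 n + ?c 2 n = n" for n
    by (induction n) (use r12 in auto)
  have count12: "count_list (map r xs) 1 + count_list (map r xs) 2 = length xs" for xs
    by (induction xs) (use r12 in auto)
  have bs_nth: "\<exists>xs. bs ! (i mod length bs) = map r xs" for i
    using run_decomposition_nth_mod[OF p bs(1)] by blast
  \<comment> \<open>A balanced run over the states 1 and 2 has even length, so the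
    \<open>div 2\<close> in \<open>BRD_type\<close> loses nothing.\<close>
  have even: "length (bs ! (i mod length bs)) = 2 * URD_type us i" for i
  proof -
    have "length (bs ! (i mod length bs)) = 2 * count_list (bs ! (i mod length bs)) 1"
      using bs_nth[of i] count12 bs(2)[OF bs_in[of i]]
      by (metis balanced_run_def length_map mult_2)
    then show ?thesis
      unfolding eq[symmetric] BRD_type_def by simp
  qed
  have T: "(\<Sum>j<i. length (bs ! (j mod length bs))) = 2 * S i" for i
    by (simp add: even S_def sum_distrib_left)
  have B: "bs ! (i mod length bs) = map r [2 * S i..<2 * S (Suc i)]" for i
    using run_decomposition_nth_mod[OF p bs(1), of i] unfolding T .
  have U: "us ! (i mod length us) = map r [S i..<S (Suc i)]" for i
    using run_decomposition_nth_mod[OF p us(1), of i] by (simp add: S_def URD_type_def)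
  have S_less: "S i < S (Suc i)" for i
    using us_in[of i] us(1) by (auto simp: S_def URD_type_def run_decomposition_def)
  have c_eq: "?c 1 (2 * S i) = ?c 2 (2 * S i)" for i
  proof (induction i)
    case 0
    then show ?case by (simp add: S_def)
  next
    case (Suc i)
    have "2 * S i \<le> 2 * S (Suc i)" using S_less[of i] by simp
    note * = count_below_add_count_list[OF this]
    have "balanced_run (map r [2 * S i..<2 * S (Suc i)])"
      using bs(2)[OF bs_in[of i]] unfolding B .
    then show ?case unfolding * using Suc by (simp add: balanced_run_def)
  qed
  have "burd r S"
  proof
    fix i n assume "S i \<le> n" "n < S (Suc i)"
    then have "r n \<in> set (map r [S i..<S (Suc i)])" "r (S i) \<in> set (map r [S i..<S (Suc i)])"
      by auto
    then show "r n = r (S i)"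
      using us(2)[OF us_in[of i]] unfolding U uniform_run_def by blast
  next
    fix i x :: nat assume "x \<in> {1, 2}"
    then show "?c x (2 * S i) = S i"
      using c_eq[of i] c_add[of "2 * S i"] by auto
  next
    show "r n \<in> {1, 2}" for n using r12[of n] by blast
    show "S 0 = 0" by (simp add: S_def)
    show "S i < S (Suc i)" for i by (rule S_less)
  qed
  then show ?thesis by blast
qed

text \<open>The identity \<open>\<sigma>\<close> gives \<open>DU\<close>, the transposition of the states gives \<open>UD\<close>:
  \<open>\<sigma> x\<close> is the state in which the rotor at vertex \<open>1 + x\<close> points to its target \<open>3 + x\<close>.\<close>

locale burd_compressor = burd +
  fixes \<sigma> :: "nat \<Rightarrow> nat" and e :: "nat \<Rightarrow> nat \<Rightarrow> nat"
  assumes \<sigma>_states: "\<And>x. x \<in> {1, 2} \<Longrightarrow> \<sigma> x \<in> {1, 2}"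
    and \<sigma>_invol: "\<And>x. x \<in> {1, 2} \<Longrightarrow> \<sigma> (\<sigma> x) = x"
    and e_source: "\<And>j. e 1 j = 1 + r j"
    and e_exit: "\<And>x j. x \<in> {1, 2} \<Longrightarrow> e (1 + x) j = (if r j = \<sigma> x then 3 + x else 1)"
begin

section \<open>Round trips from the source that end at a target\<close>

abbreviation visits :: "nat \<Rightarrow> nat \<Rightarrow> nat" where
  "visits x \<equiv> count_below (\<lambda>j. r j = x)"

text \<open>Departure \<open>n\<close> from the source leads to vertex \<open>1 + r n\<close>, which
  has been left \<open>visits (r n) n\<close> times before; the condition says that its rotor then
  points to the target.\<close>

definition exits :: "nat \<Rightarrow> bool" where
  "exits n \<longleftrightarrow> r (visits (r n) n) = \<sigma> (r n)"

lemma S_mono: "i \<le> j \<Longrightarrow> S i \<le> S j"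
  by (rule lift_Suc_mono_le) (auto intro: less_imp_le S_less_Suc)

lemma le_S: "i \<le> S i"
  by (induction i) (use S_less_Suc Suc_leI le_less_trans in blast)+

lemma ex_run: "\<exists>i. 2 * S i \<le> n \<and> n < 2 * S (Suc i)"
proof (induction n)
  case 0
  then show ?case using S_0 S_less_Suc[of 0] by (intro exI[of _ 0]) simp
next
  case (Suc n)
  then obtain i where "2 * S i \<le> n" "n < 2 * S (Suc i)" by blast
  then show ?case
    using S_less_Suc[of "Suc i"] by (cases "Suc n < 2 * S (Suc i)") (auto intro: exI[of _ i] exI[of _ "Suc i"])
qed

text \<open>Each state has been seen \<open>S i\<close> times at the start of the balanced run and
  \<open>S (Suc i)\<close> times at its end. The upper bound is strict because departure
  \<open>n\<close> itself is counted by the end.\<close>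

lemma visits_bounds:
  assumes "2 * S i \<le> n" "n < 2 * S (Suc i)"
  shows "S i \<le> visits (r n) n" "visits (r n) n < S (Suc i)"
proof -
  show "S i \<le> visits (r n) n"
    using count_below_mono[OF assms(1), of "\<lambda>j. r j = r n"] balanced[OF states, of n i] by simp
  have "visits (r n) (Suc n) \<le> visits (r n) (2 * S (Suc i))"
    using assms(2) by (intro count_below_mono) simp
  then show "visits (r n) n < S (Suc i)"
    using balanced[OF states, of n "Suc i"] by simp
qed

text \<open>The rotor position consulted lies in the \<open>i\<close>-th uniform run, so the state
  read there is \<open>r (S i)\<close>; the involution moves \<open>\<sigma>\<close> to the other
  side.\<close>

lemma exits_in_run:
  assumes "2 * S i \<le> n" "n < 2 * S (Suc i)"
  shows "exits n \<longleftrightarrow> r n = \<sigma> (r (S i))"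
proof -
  have "r (visits (r n) n) = r (S i)"
    using visits_bounds[OF assms] by (rule uniform)
  then show ?thesis
    unfolding exits_def using \<sigma>_invol[OF states, of n] \<sigma>_invol[OF states, of "S i"] by metis
qed

text \<open>Both counts equal \<open>S i\<close> at the start of the run and then grow at the same
  departures. The first assumption is the induction hypothesis for
  \<open>count_exits_S\<close>.\<close>

lemma count_exits_run_step:
  assumes "count_below exits (2 * S i) = S i" "2 * S i \<le> n" "n \<le> 2 * S (Suc i)"
  shows "count_below exits n = visits (\<sigma> (r (S i))) n"
  using assms(2,3)
proof (induction n rule: dec_induct)
  case base
  then show ?case using balanced[OF \<sigma>_states[OF states]] assms(1) by simp
next
  case (step n)
  then show ?case using exits_in_run[of i n] by simp
qed

lemma count_exits_S: "count_below exits (2 * S i) = S i"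
proof (induction i)
  case 0
  then show ?case by (simp add: S_0)
next
  case (Suc i)
  then show ?case
    using count_exits_run_step[of i "2 * S (Suc i)"] S_less_Suc[of i]
      balanced[OF \<sigma>_states[OF states]] by simp
qed

text \<open>Within the run, the number of earlier exits equals the rotor position just consulted, so
  it indexes the same uniform run and can replace \<open>S i\<close>.\<close>

lemma exits_state:
  assumes "exits n"
  shows "r n = \<sigma> (r (count_below exits n))"
proof -
  obtain i where i: "2 * S i \<le> n" "n < 2 * S (Suc i)" using ex_run by blast
  then have "r n = \<sigma> (r (S i))" using exits_in_run assms by blast
  moreover have "count_below exits n = visits (r n) n"
    using count_exits_run_step[OF count_exits_S i(1)] i(2) calculation by simp
  ultimately show ?thesis using uniform[OF visits_bounds[OF i]] by simp
qed

section \<open>From round trips to the particle's walk\<close>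

definition walk_state :: "nat \<Rightarrow> nat \<times> (nat \<Rightarrow> nat)" where
  "walk_state t = (rotor_step e 1 {4, 5} ^^ t) (1, \<lambda>_. 0)"

abbreviation hits :: "nat \<Rightarrow> bool" where
  "hits t \<equiv> rotor_walk e 1 {4, 5} t \<in> {4, 5}"

text \<open>The three disjuncts are the phases of the round trip of the particle that begins with the
  \<open>n\<close>-th departure from the source.\<close>

lemma walk_invariant:
  "\<exists>n v c. walk_state t = (v, c) \<and> count_below hits t = count_below exits n \<and>
     (v = 1 \<and> t \<le> 3 * n \<and> c 1 = n \<and> c 2 = visits 1 n \<and> c 3 = visits 2 n \<or>
      v = 1 + r n \<and> t \<le> 3 * n + 1 \<and> c 1 = Suc n \<and> c 2 = visits 1 n \<and> c 3 = visits 2 n \<or>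
      v = 3 + r n \<and> exits n \<and> t \<le> 3 * n + 2 \<and>
        c 1 = Suc n \<and> c 2 = visits 1 (Suc n) \<and> c 3 = visits 2 (Suc n))"
  (is "\<exists>n v c. ?I t n v c")
proof (induction t)
  case 0
  show ?case by (intro exI[of _ 0] exI[of _ 1] exI[of _ "\<lambda>_. 0"]) (simp add: walk_state_def)
next
  case (Suc t)
  then obtain n v c where I: "?I t n v c" by blast
  have st: "walk_state t = (v, c)" using I by blast
  have next_state: "walk_state (Suc t) =
      (if v \<in> {4, 5} then (1, c) else (e v (c v), c(v := Suc (c v))))"
    using st by (simp add: walk_state_def rotor_step_def)
  \<comment> \<open>Only strictly earlier times are counted, so a hit is registered on leaving the
    target, just when \<open>n\<close> advances past the exit.\<close>
  have count: "count_below hits (Suc t) = count_below exits n + (if v \<in> {4, 5} then 1 else 0)"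
    using I by (simp add: walk_state_def rotor_walk_def)
  have rn: "r n = 1 \<or> r n = 2" using states[of n] by auto
  from I consider
      (source) "v = 1" "t \<le> 3 * n" "c 1 = n" "c 2 = visits 1 n" "c 3 = visits 2 n"
    | (inner) "v = 1 + r n" "t \<le> 3 * n + 1" "c 1 = Suc n" "c 2 = visits 1 n" "c 3 = visits 2 n"
    | (target) "v = 3 + r n" "exits n" "t \<le> 3 * n + 2" "c 1 = Suc n"
        "c 2 = visits 1 (Suc n)" "c 3 = visits 2 (Suc n)"
    by blast
  then show ?case
  proof cases
    case source
    then have "?I (Suc t) n (1 + r n) (c(1 := Suc n))"
      using next_state count e_source by (simp add: fun_upd_def)
    then show ?thesis by (intro exI)
  next
    case inner
    have vr: "v = 2 \<and> r n = 1 \<or> v = 3 \<and> r n = 2" using inner(1) rn by auto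
    then have v: "v \<notin> {4, 5}" "c v = visits (r n) n" using inner(4,5) by auto
    have exit: "e v (c v) = (if exits n then 3 + r n else 1)"
      using e_exit[OF states, of n "c v"] v(2) inner(1) by (simp add: exits_def)
    show ?thesis
    proof (cases "exits n")
      case True
      then have "?I (Suc t) n (3 + r n) (c(v := Suc (c v)))"
        using next_state count exit v inner(2-5) vr by (auto simp: fun_upd_def)
      then show ?thesis by (intro exI)
    next
      case False
      then have "?I (Suc t) (Suc n) 1 (c(v := Suc (c v)))"
        using next_state count exit v inner(2-5) vr by (auto simp: fun_upd_def)
      then show ?thesis by (intro exI)
    qed
  next
    case target
    then have "?I (Suc t) (Suc n) 1 c"
      using next_state count rn by auto
    then show ?thesis by (intro exI)
  qed
qed

lemma rotor_walk_hit:
  assumes "hits t"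
  shows "rotor_walk e 1 {4, 5} t = 3 + \<sigma> (r (count_below hits t))"
proof -
  obtain n v c where w: "walk_state t = (v, c)" and h: "count_below hits t = count_below exits n"
    and v: "v = 1 \<or> v = 1 + r n \<or> v = 3 + r n \<and> exits n"
    using walk_invariant[of t] by blast
  have wv: "rotor_walk e 1 {4, 5} t = v"
    using w by (simp add: walk_state_def rotor_walk_def)
  then have "v \<noteq> 1" "v \<noteq> 1 + r n" using assms states[of n] by auto
  with v have v_eq: "v = 3 + r n" and "exits n" by blast+
  show ?thesis
    unfolding wv h exits_state[OF \<open>exits n\<close>, symmetric] by (rule v_eq)
qed

text \<open>A round trip takes at most three steps, so late times belong to late departures, which
  have arbitrarily many exits before them.\<close>

lemma infinite_hits: "infinite {t. hits t}"
proof
  assume fin: "finite {t. hits t}"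
  define M where "M = card {t. hits t}"
  \<comment> \<open>With \<open>t \<le> 3 * n + 2\<close> this forces \<open>n\<close> to reach
    \<open>2 * S (Suc M)\<close>, hence at least \<open>S (Suc M) > M\<close> exits.\<close>
  define t where "t = 3 * (2 * S (Suc M)) + 2"
  obtain n where n: "count_below hits t = count_below exits n" "t \<le> 3 * n + 2"
    using walk_invariant[of t] by (elim exE conjE disjE) simp_all
  have "count_below hits t \<le> M"
    unfolding count_below_def M_def using fin by (intro card_mono) auto
  moreover have "S (Suc M) \<le> count_below exits n"
    using count_below_mono[of "2 * S (Suc M)" n exits] n(2) by (simp add: count_exits_S t_def)
  ultimately show False using le_S[of "Suc M"] n(1) by simp
qed

lemma hitting_sequence_eq: "hitting_sequence e 1 {4, 5} = (\<lambda>k. 3 + \<sigma> (r k))"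
proof
  fix k
  have "hits (enumerate {t. hits t} k)"
    using enumerate_in_set[OF infinite_hits, of k] by (rule CollectD)
  from rotor_walk_hit[OF this] show "hitting_sequence e 1 {4, 5} k = 3 + \<sigma> (r k)"
    unfolding hitting_sequence_def count_below_enumerate[OF infinite_hits] .
qed

end

theorem theorem7p11:
  fixes r :: "nat \<Rightarrow> nat"
  assumes "BURD_rotor_type r"
  shows "relabel_equiv (UD r) (DU r) \<and> relabel_equiv (DU r) r"
proof -
  obtain S where "burd r S" using BURD_rotor_type_burd[OF assms] by blast
  then interpret burd r S .
  have r12: "r n = 1 \<or> r n = 2" for n using states[of n] by auto
  have "burd_compressor r S (\<lambda>x. x) (compressor r VariantD VariantU)"
  proof
    show "compressor r VariantD VariantU 1 j = 1 + r j" for j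
      using r12[of j] by (elim disjE) (simp_all add: compressor_def)
    show "compressor r VariantD VariantU (1 + x) j = (if r j = x then 3 + x else 1)"
      if "x \<in> {1, 2}" for x j
      using that r12[of j] by (elim insertE emptyE disjE) (simp_all add: compressor_def)
  qed auto
  then have DU: "DU r = (\<lambda>k. 3 + r k)"
    unfolding DU_def by (rule burd_compressor.hitting_sequence_eq)
  have "burd_compressor r S (\<lambda>x. 3 - x) (compressor r VariantU VariantD)"
  proof
    show "compressor r VariantU VariantD 1 j = 1 + r j" for j
      using r12[of j] by (elim disjE) (simp_all add: compressor_def)
    show "compressor r VariantU VariantD (1 + x) j = (if r j = 3 - x then 3 + x else 1)"
      if "x \<in> {1, 2}" for x j
      using that r12[of j] by (elim insertE emptyE disjE) (simp_all add: compressor_def)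
  qed auto
  then have UD: "UD r = (\<lambda>k. 3 + (3 - r k))"
    unfolding UD_def by (rule burd_compressor.hitting_sequence_eq)
  have "relabel_equiv (UD r) (DU r)"
    unfolding relabel_equiv_def UD DU
  \<comment> \<open>This map exchanges the targets 4 and 5.\<close>
  proof (intro exI[of _ "\<lambda>x. 9 - x"] conjI ext)
    show "inj_on (\<lambda>x. 9 - x) (range (\<lambda>k. 3 + (3 - r k)))"
      by (auto simp: inj_on_def)
    show "3 + r k = ((\<lambda>x. 9 - x) \<circ> (\<lambda>k. 3 + (3 - r k))) k" for k
      using r12[of k] by auto
  qed
  moreover have "relabel_equiv (DU r) r"
    unfolding relabel_equiv_def DU
    \<comment> \<open>Targets 4 and 5 become states 1 and 2; truncated subtraction is injective here
      because all values are at least 3.\<close>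
    by (intro exI[of _ "\<lambda>x. x - 3"]) (auto simp: inj_on_def)
  ultimately show ?thesis ..
qed

end
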